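(* Let $A=\{1,a_2,a_3,\ldots\}$ be a (finite or infinite) set of positive integers with $1<a_2<a_3<\cdots$ such that $a_k-a_l\geqslant a_3$ for every $k>l\geqslant 3$ and $2a_2\leqslant a_3$. Suppose that the inequality $$p_A(w)\,p_A(z)>p_A(w+z)$$ holds for all integers $w,z\geqslant a_3$ with $2a_3\leqslant w+z\leqslant 2(a_3+a_2)-1$. Then $p_A(w)\,p_A(z)>p_A(w+z)$ holds for all integers $w,z\geqslant a_3$.
   Context: For a set $A$ of positive integers, an $A$-partition of a non-negative integer $n$ is a partition of $n$ (a weakly decreasing sequence of positive integers summing to $n$) all of whose parts belong to $A$. The $A$-partition function $p_A(n)$ is the number of $A$-partitions of $n$; equivalently $\sum_{n\ge0}p_A(n)q^n=\prod_{a\in A}(1-q^a)^{-1}$. *)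

theory Defs
  imports Main
begin

definition partitions_in :: "nat set \<Rightarrow> nat \<Rightarrow> nat list set" where
  "partitions_in A n =
     {xs. sorted_wrt (\<ge>) xs \<and> (\<forall>x\<in>set xs. 0 < x \<and> x \<in> A) \<and> sum_list xs = n}"

definition pA :: "nat set \<Rightarrow> nat \<Rightarrow> nat" where
  "pA A n = card (partitions_in A n)"

text \<open>Since \<open>card\<close> is \<open>0\<close> on infinite sets, \<open>pA\<close> counts properly only because of the following fact.\<close>

lemma finite_partitions_in: "finite (partitions_in A n)"
proof (rule finite_subset)
  have len: "length xs \<le> sum_list xs" if "\<forall>x\<in>set xs. 0 < x" for xs :: "nat list"
    using that by (induction xs) auto
  show "partitions_in A n \<subseteq> {xs. set xs \<subseteq> {..n} \<and> length xs \<le> n}"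
    using len member_le_sum_list by (fastforce simp: partitions_in_def)
  show "finite {xs. set xs \<subseteq> {..n} \<and> length xs \<le> n}"
    by (rule finite_lists_length_le) simp
qed

text \<open>The set \<open>A = {a 1, a 2, a 3, \<dots>}\<close> is given by its increasing enumeration \<open>a\<close>, indexed from 1;
  values of \<open>a\<close> outside the index set are irrelevant. As \<open>a 3\<close> must exist, a finite
  index set has at least three elements.\<close>

definition index_set :: "nat set \<Rightarrow> bool" where
  "index_set I \<longleftrightarrow> I = {1..} \<or> (\<exists>m\<ge>3. I = {1..m})"

end

theory Submission
  imports Defs "HOL-Library.FuncSet" "HOL-Library.Multiset"
begin

text \<open>Write \<open>e = a 2\<close>, \<open>d = a 3\<close>, \<open>B = A - {e}\<close>. Since \<open>pA A n = pA B n + pA A (n - e)\<close>, induction on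
  \<open>w + z\<close> with \<open>z \<ge> d + e\<close> reduces the claim to \<open>pA B (w + z) \<le> pA A w * pA B z\<close>. The inequality
  \<open>pA B (w + z) \<le> pA B w * pA B z\<close> is false in general, because integer parts of quotients by \<open>d\<close>
  are not additive, but \<open>pA B (w + z) \<le> pA B (w + d) * pA B z\<close> is true, and the part \<open>e \<le> d / 2\<close>
  makes up for the shift: \<open>pA B (w + d) \<le> pA A w\<close>. For the former, peel off parts \<open>t > d\<close> that are
  at most one of the two arguments; once no such part is left, partitions of \<open>w + z\<close> use at most
  one part exceeding \<open>d\<close>, and can be counted.\<close>

section \<open>Partitions as multisets, and the basic recurrences\<close>

text \<open>On multisets, inserting or deleting a part needs no re-sorting, which suits the
  recurrence \<open>pA_peel\<close>. Subtracting \<open>{0}\<close> encodes positivity of the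
  parts.\<close>

lemma pA_multisets:
  "pA A n = card {M. set_mset M \<subseteq> A - {0} \<and> sum_mset M = n}"
proof -
  have "bij_betw mset (partitions_in A n) {M. set_mset M \<subseteq> A - {0} \<and> sum_mset M = n}"
  proof (rule bij_betwI[where g = "\<lambda>M. rev (sorted_list_of_multiset M)"])
    show "mset \<in> partitions_in A n \<rightarrow> {M. set_mset M \<subseteq> A - {0} \<and> sum_mset M = n}"
      by (auto simp: partitions_in_def sum_mset_sum_list)
    show "(\<lambda>M. rev (sorted_list_of_multiset M))
        \<in> {M. set_mset M \<subseteq> A - {0} \<and> sum_mset M = n} \<rightarrow> partitions_in A n"
    proof
      fix M assume "M \<in> {M. set_mset M \<subseteq> A - {0} \<and> sum_mset M = n}"
      moreover have "sum_list (sorted_list_of_multiset M) = sum_mset M"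
        by (metis mset_sorted_list_of_multiset sum_mset_sum_list)
      ultimately show "rev (sorted_list_of_multiset M) \<in> partitions_in A n"
        by (auto simp: partitions_in_def sorted_wrt_rev sum_list_rev)
    qed
    show "rev (sorted_list_of_multiset (mset xs)) = xs" if "xs \<in> partitions_in A n" for xs
    proof -
      have "sorted (rev xs)" using that by (simp add: partitions_in_def sorted_wrt_rev)
      then have "sort (rev xs) = rev xs" by (rule sorted_sort_id)
      then show ?thesis
        by (metis mset_rev rev_rev_ident sorted_list_of_multiset_mset)
    qed
    show "mset (rev (sorted_list_of_multiset M)) = M"
      if "M \<in> {M. set_mset M \<subseteq> A - {0} \<and> sum_mset M = n}" for M
      by simp
  qed
  then show ?thesis unfolding pA_def by (rule bij_betw_same_card)
qed

lemma finite_multisets_of_sum: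
  "finite {M :: nat multiset. set_mset M \<subseteq> A - {0} \<and> sum_mset M = n}"
proof (rule finite_subset)
  show "{M. set_mset M \<subseteq> A - {0} \<and> sum_mset M = n} \<subseteq> mset ` partitions_in A n"
  proof
    fix M assume "M \<in> {M. set_mset M \<subseteq> A - {0} \<and> sum_mset M = n}"
    moreover have "sum_list (sorted_list_of_multiset M) = sum_mset M"
      by (metis mset_sorted_list_of_multiset sum_mset_sum_list)
    ultimately have "rev (sorted_list_of_multiset M) \<in> partitions_in A n"
      by (auto simp: partitions_in_def sorted_wrt_rev sum_list_rev)
    then show "M \<in> mset ` partitions_in A n"
      by (metis image_eqI mset_rev mset_sorted_list_of_multiset)
  qed
qed (simp add: finite_partitions_in)

text \<open>Partitions are split by whether \<open>b\<close> occurs; those containing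
  \<open>b\<close> correspond to partitions of \<open>n - b\<close> by deleting one copy. All later
  inductions run on this recurrence.\<close>

lemma pA_peel:
  assumes "b \<in> A" "0 < b" "b \<le> n"
  shows "pA A n = pA (A - {b}) n + pA A (n - b)"
proof -
  let ?P = "\<lambda>A n. {M. set_mset M \<subseteq> A - {0::nat} \<and> sum_mset M = n}"
  have split: "?P A n = ?P (A - {b}) n \<union> add_mset b ` ?P A (n - b)"
  proof (intro equalityI subsetI)
    fix M assume M: "M \<in> ?P A n"
    show "M \<in> ?P (A - {b}) n \<union> add_mset b ` ?P A (n - b)"
    proof (cases "b \<in># M")
      case True
      then obtain N where N: "M = add_mset b N" by (metis insert_DiffM)
      then have "N \<in> ?P A (n - b)" using M by auto
      then show ?thesis using N by blast
    next
      case False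
      then show ?thesis using M by auto
    qed
  next
    fix M assume "M \<in> ?P (A - {b}) n \<union> add_mset b ` ?P A (n - b)"
    then show "M \<in> ?P A n" using assms by auto
  qed
  have "card (?P A n) = card (?P (A - {b}) n) + card (add_mset b ` ?P A (n - b))"
    unfolding split
  proof (rule card_Un_disjoint)
    show "?P (A - {b}) n \<inter> add_mset b ` ?P A (n - b) = {}"
    proof (rule equals0I)
      fix M assume M: "M \<in> ?P (A - {b}) n \<inter> add_mset b ` ?P A (n - b)"
      then have "set_mset M \<subseteq> A - {b} - {0}" by simp
      then have "b \<notin># M" by blast
      moreover from M obtain N where "M = add_mset b N" by blast
      ultimately show False by simp
    qed
    show "finite (?P (A - {b}) n)" by (rule finite_multisets_of_sum)
    show "finite (add_mset b ` ?P A (n - b))"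
      by (rule finite_imageI) (rule finite_multisets_of_sum)
  qed
  also have "card (add_mset b ` ?P A (n - b)) = card (?P A (n - b))"
    by (rule card_image) (simp add: inj_on_def)
  finally show ?thesis by (simp add: pA_multisets)
qed

lemma pA_cong_le:
  assumes "A \<inter> {..n} = B \<inter> {..n}"
  shows "pA A n = pA B n"
proof -
  have *: "partitions_in A n \<subseteq> partitions_in B n" if "A \<inter> {..n} = B \<inter> {..n}" for A B
    using that member_le_sum_list by (fastforce simp: partitions_in_def)
  show ?thesis unfolding pA_def using *[OF assms] *[OF assms[symmetric]] by auto
qed

lemma pA_mono_set: "A \<subseteq> B \<Longrightarrow> pA A n \<le> pA B n"
  unfolding pA_def
  by (rule card_mono[OF finite_partitions_in]) (auto simp: partitions_in_def)

lemma pA_0: "pA A 0 = 1"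
proof -
  have "xs = []" if "xs \<in> partitions_in A 0" for xs
    using that by (cases xs) (auto simp: partitions_in_def)
  then have "partitions_in A 0 = {[]}"
    by (auto simp: partitions_in_def)
  then show ?thesis by (simp add: pA_def)
qed

lemma pA_mono:
  assumes "1 \<in> A" "m \<le> n"
  shows "pA A m \<le> pA A n"
  using assms(2)
proof (induction rule: dec_induct)
  case (step k)
  have "pA A (Suc k) = pA (A - {1}) (Suc k) + pA A (Suc k - 1)"
    using assms(1) by (intro pA_peel) auto
  then show ?case using step by simp
qed simp

lemma pA_pos: "1 \<in> A \<Longrightarrow> 1 \<le> pA A n"
  using pA_mono[of A 0 n] by (simp add: pA_0)

lemma pA_singleton_1: "pA {1} n = 1"
proof (induction n)
  case (Suc n)
  have "pA {1} (Suc n) = pA ({1} - {1}) (Suc n) + pA {1} (Suc n - 1)"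
    by (rule pA_peel) auto
  moreover have "partitions_in {} (Suc n) = {}"
    by (auto simp: partitions_in_def)
  ultimately show ?case using Suc by (simp add: pA_def)
qed (simp add: pA_0)

lemma pA_1_d:
  assumes "1 < d"
  shows "pA {1, d} n = n div d + 1"
proof (induction n rule: less_induct)
  case (less n)
  show ?case
  proof (cases "n < d")
    case True
    then have "pA {1, d} n = pA {1} n" by (intro pA_cong_le) auto
    then show ?thesis using True by (simp add: pA_singleton_1 del: One_nat_def)
  next
    case False
    have "{1, d} - {d} = {1}" using assms by auto
    then have "pA {1, d} n = pA {1} n + pA {1, d} (n - d)"
      using pA_peel[of d "{1, d}" n] assms False by simp
    then show ?thesis using less[of "n - d"] assms False
      by (simp add: pA_singleton_1 le_div_geq del: One_nat_def)
  qed
qed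

section \<open>Submultiplicativity at the cost of a shift by \<open>d\<close>\<close>

text \<open>Models the parts beyond \<open>d = a 3\<close>: the bound \<open>2 * d\<close> is the
  gap above \<open>a 3\<close> itself, the second clause the gap between later parts. Distinct
  elements thus have distinct quotients by \<open>d\<close>.\<close>

definition spaced :: "nat \<Rightarrow> nat set \<Rightarrow> bool" where
  "spaced d T \<longleftrightarrow> (\<forall>t\<in>T. 2 * d \<le> t \<and> (\<forall>s\<in>T. s < t \<longrightarrow> s + d \<le> t))"

lemma spaced_subset: "spaced d T \<Longrightarrow> S \<subseteq> T \<Longrightarrow> spaced d S"
  unfolding spaced_def by blast

text \<open>Since \<open>s = t\<close> is allowed in the last hypothesis, no two parts from
  \<open>T\<close> fit into \<open>n\<close>, equal or not. Once the single large part
  \<open>t\<close> is chosen, only the multiplicity of \<open>d\<close> in \<open>n - t\<close> is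
  free.\<close>

lemma pA_at_most_one_large_part:
  assumes "finite T" "1 < d" "\<forall>t\<in>T. d < t" "\<forall>s\<in>T. \<forall>t\<in>T. n < s + t"
  shows "pA ({1, d} \<union> T) n = n div d + 1 + (\<Sum>t\<in>{t\<in>T. t \<le> n}. (n - t) div d + 1)"
  using assms(1,3,4)
proof (induction T rule: finite_induct)
  case empty
  then show ?case using assms(2) by (simp add: pA_1_d del: One_nat_def)
next
  case (insert b T)
  have IH: "pA ({1, d} \<union> T) n = n div d + 1 + (\<Sum>t\<in>{t\<in>T. t \<le> n}. (n - t) div d + 1)"
    using insert by simp
  show ?case
  proof (cases "b \<le> n")
    case False
    then have "pA ({1, d} \<union> insert b T) n = pA ({1, d} \<union> T) n"
      by (intro pA_cong_le) auto
    moreover have "{t\<in>insert b T. t \<le> n} = {t\<in>T. t \<le> n}" using False by auto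
    ultimately show ?thesis using IH by simp
  next
    case True
    have "b \<noteq> 1" "b \<noteq> d" "0 < b" using insert.prems assms(2) by auto
    then have "({1, d} \<union> insert b T) - {b} = {1, d} \<union> T" using insert.hyps by auto
    then have "pA ({1, d} \<union> insert b T) n = pA ({1, d} \<union> T) n + pA ({1, d} \<union> insert b T) (n - b)"
      using pA_peel[of b "{1, d} \<union> insert b T" n] True \<open>0 < b\<close> by simp
    also have "pA ({1, d} \<union> insert b T) (n - b) = pA {1, d} (n - b)"
      using insert.prems(2) True by (intro pA_cong_le) fastforce
    also have "\<dots> = (n - b) div d + 1" using assms(2) by (rule pA_1_d)
    finally have "pA ({1, d} \<union> insert b T) n = pA ({1, d} \<union> T) n + ((n - b) div d + 1)" .
    moreover have "{t\<in>insert b T. t \<le> n} = insert b {t\<in>T. t \<le> n}" using True by auto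
    ultimately show ?thesis using IH insert.hyps by simp
  qed
qed

lemma div_less_of_gap:
  fixes x y d :: nat
  assumes "0 < d" "x + d \<le> y"
  shows "x div d < y div d"
proof -
  have "(x + d) div d \<le> y div d" using assms(2) by (rule div_le_mono)
  moreover have "(x + d) div d = x div d + 1"
    using assms(1) by (intro div_add_self2) simp
  ultimately show ?thesis by linarith
qed

text \<open>With \<open>x = u div d\<close> and \<open>y = z div d\<close>, the right side is
  \<open>(x + 1) * (y + 1)\<close>. Partitions of \<open>n\<close> without a large part number at
  most \<open>x + y + 1\<close>; those with one number at most \<open>x * y\<close>.\<close>

lemma pA_submult_small:
  assumes "finite T" "1 < d" "spaced d T" "n + d \<le> u + z" "u \<le> z" "\<forall>t\<in>T. z < t"
  shows "pA ({1, d} \<union> T) n \<le> pA ({1, d} \<union> T) u * pA ({1, d} \<union> T) z"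
proof -
  let ?x = "u div d" and ?y = "z div d" and ?S = "{t\<in>T. t \<le> n}"
  have small: "pA ({1, d} \<union> T) m = m div d + 1" if "m \<le> z" for m
  proof -
    have "pA ({1, d} \<union> T) m = pA {1, d} m"
      using that assms(6) by (intro pA_cong_le) fastforce
    then show ?thesis using assms(2) by (simp add: pA_1_d del: One_nat_def)
  qed
  \<comment> \<open>The loss of \<open>d\<close> absorbs the carry:
    \<open>n + d \<le> u + z < (x + y + 2) * d\<close>.\<close>
  have n: "n div d < ?x + ?y + 1"
  proof -
    have "u < d * (?x + 1)" "z < d * (?y + 1)"
      using assms(2) by (simp_all add: dividend_less_times_div)
    then have "n < (?x + ?y + 1) * d" using assms(4) by (simp add: algebra_simps)
    then show ?thesis using assms(2) by (simp add: div_less_iff_less_mult)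
  qed
  \<comment> \<open>The remainders \<open>n - t\<close> inherit the gaps of \<open>T\<close>, so
    their quotients are distinct; as \<open>t > z\<close>, each satisfies
    \<open>n - t + d \<le> u\<close>, so its quotient is below \<open>x\<close>.\<close>
  have "(\<Sum>t\<in>?S. (n - t) div d + 1) \<le> (\<Sum>i<?x. i + 1)"
  proof -
    let ?g = "\<lambda>t. (n - t) div d"
    have lt: "?g t \<noteq> ?g s" if "s \<in> ?S" "t \<in> ?S" "s < t" for s t
    proof -
      have "s + d \<le> t" using assms(3) that by (simp add: spaced_def)
      then have "n - t + d \<le> n - s" using that by simp
      then show ?thesis using div_less_of_gap assms(2) by (metis less_irrefl zero_less_one less_trans)
    qed
    have inj: "inj_on ?g ?S"
    proof (rule inj_onI)
      fix s t assume "s \<in> ?S" "t \<in> ?S" "?g s = ?g t"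
      then show "s = t" using lt[of s t] lt[of t s] by (metis linorder_neqE_nat)
    qed
    have "?g ` ?S \<subseteq> {..<?x}"
    proof clarify
      fix t assume "t \<in> T" "t \<le> n"
      then have "(n - t) + d \<le> u" using assms(4,6) by fastforce
      then show "?g t < ?x" using assms(2) by (intro div_less_of_gap) auto
    qed
    then have "(\<Sum>i\<in>?g ` ?S. i + 1) \<le> (\<Sum>i<?x. i + 1)" by (intro sum_mono2) auto
    then show ?thesis by (simp add: sum.reindex[OF inj])
  qed
  also have "(\<Sum>i<k. i + 1) \<le> k * k" for k :: nat
    by (induction k) auto
  also have "?x * ?x \<le> ?x * ?y"
    using assms(5) by (simp add: div_le_mono)
  finally have "(\<Sum>t\<in>?S. (n - t) div d + 1) \<le> ?x * ?y" .
  moreover have "pA ({1, d} \<union> T) n = n div d + 1 + (\<Sum>t\<in>?S. (n - t) div d + 1)"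
  proof (rule pA_at_most_one_large_part[OF assms(1,2)])
    show "\<forall>t\<in>T. d < t" using assms(2,3) by (fastforce simp: spaced_def)
    \<comment> \<open>Two parts above \<open>z\<close> exceed \<open>2 * z \<ge> u + z\<close>,
      hence exceed \<open>n\<close>.\<close>
    show "\<forall>s\<in>T. \<forall>t\<in>T. n < s + t"
    proof (intro ballI)
      fix s t assume "s \<in> T" "t \<in> T"
      then have "z < s" "z < t" using assms(6) by auto
      then show "n < s + t" using assms(4,5) by linarith
    qed
  qed
  ultimately have "pA ({1, d} \<union> T) n \<le> ?x + ?y + 1 + ?x * ?y"
    using n by linarith
  then show ?thesis using small[of u] small[of z] assms(5) by (simp add: algebra_simps)
qed

text \<open>\<open>pA_peel\<close> splits the counts for \<open>n\<close> and \<open>z\<close> while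
  the factor for \<open>u\<close> stays whole. The summands without \<open>b\<close> compare by the
  first inequality, after enlarging \<open>A - {b}\<close> to \<open>A\<close> in that factor, and
  those with \<open>b\<close> by the second.\<close>

lemma pA_submult_peel:
  assumes "b \<in> A" "0 < b" "b \<le> z"
    and A': "pA (A - {b}) n \<le> pA (A - {b}) u * pA (A - {b}) z"
    and IH: "b \<le> n \<Longrightarrow> pA A (n - b) \<le> pA A u * pA A (z - b)"
  shows "pA A n \<le> pA A u * pA A z"
proof -
  have le: "pA (A - {b}) n \<le> pA A u * pA (A - {b}) z"
    using A' pA_mono_set[of "A - {b}" A u] by (meson Diff_subset le_trans mult_le_mono1)
  have z: "pA A z = pA (A - {b}) z + pA A (z - b)" using assms by (intro pA_peel)
  show ?thesis
  proof (cases "b \<le> n")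
    case True
    then have "pA A n = pA (A - {b}) n + pA A (n - b)" using assms by (intro pA_peel)
    then show ?thesis using le z IH[OF True] by (simp add: distrib_left add_mono)
  next
    case False
    then have "pA A n = pA (A - {b}) n" by (intro pA_cong_le) auto
    then show ?thesis using le z by (simp add: distrib_left)
  qed
qed

text \<open>Peeling \<open>b\<close> leads either to \<open>T - {b}\<close> or to smaller arguments,
  hence an outer induction on \<open>T\<close> and an inner one on \<open>u + z\<close>.\<close>

lemma pA_submult_finite:
  assumes "finite T" "1 < d" "spaced d T" "n + d \<le> u + z"
  shows "pA ({1, d} \<union> T) n \<le> pA ({1, d} \<union> T) u * pA ({1, d} \<union> T) z"
  using assms(1,3,4)
proof (induction T arbitrary: n u z rule: finite_psubset_induct)
  case (psubset T)
  have peel: "pA ({1, d} \<union> T) n \<le> pA ({1, d} \<union> T) u * pA ({1, d} \<union> T) z"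
    if "b \<in> T" "b \<le> z" "n + d \<le> u + z"
      "b \<le> n \<Longrightarrow> pA ({1, d} \<union> T) (n - b) \<le> pA ({1, d} \<union> T) u * pA ({1, d} \<union> T) (z - b)"
    for b n u z
  proof (rule pA_submult_peel)
    have b: "2 * d \<le> b" using psubset.prems(1) that by (simp add: spaced_def)
    then have eq: "({1, d} \<union> T) - {b} = {1, d} \<union> (T - {b})" using assms(2) by auto
    show "pA ({1, d} \<union> T - {b}) n \<le> pA ({1, d} \<union> T - {b}) u * pA ({1, d} \<union> T - {b}) z"
      unfolding eq
    proof (rule psubset.IH)
      show "T - {b} \<subset> T" using that(1) by blast
      show "spaced d (T - {b})" using psubset.prems(1) by (rule spaced_subset) blast
    qed (fact that(3))
    show "b \<in> {1, d} \<union> T" using that(1) by simp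
    show "0 < b" using b assms(2) by simp
  qed (fact that)+
  \<comment> \<open>Subtracting \<open>b\<close> from \<open>n\<close> and from one of
    \<open>u\<close>, \<open>z\<close> preserves \<open>n + d \<le> u + z\<close>. When
    \<open>b\<close> fits into neither, \<open>pA_submult_small\<close> applies to the arguments in
    increasing order.\<close>
  from psubset.prems(2) show ?case
  proof (induction "u + z" arbitrary: n u z rule: less_induct)
    case less
    consider b where "b \<in> T" "b \<le> z" | b where "b \<in> T" "b \<le> u"
      | "\<forall>t\<in>T. z < t \<and> u < t" by force
    then show ?case
    proof cases
      case 1
      then have "0 < b" using psubset.prems(1) assms(2) by (fastforce simp: spaced_def)
      show ?thesis
      proof (rule peel[OF 1 less.prems])
        assume "b \<le> n"
        then show "pA ({1, d} \<union> T) (n - b) \<le> pA ({1, d} \<union> T) u * pA ({1, d} \<union> T) (z - b)"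
          using 1 \<open>0 < b\<close> less.prems by (intro less.hyps) linarith+
      qed
    next
      case 2
      then have "0 < b" using psubset.prems(1) assms(2) by (fastforce simp: spaced_def)
      have "pA ({1, d} \<union> T) n \<le> pA ({1, d} \<union> T) z * pA ({1, d} \<union> T) u"
      proof (rule peel[OF 2])
        show "n + d \<le> z + u" using less.prems by linarith
        assume "b \<le> n"
        then show "pA ({1, d} \<union> T) (n - b) \<le> pA ({1, d} \<union> T) z * pA ({1, d} \<union> T) (u - b)"
          using 2 \<open>0 < b\<close> less.prems by (intro less.hyps) linarith+
      qed
      then show ?thesis by (simp add: mult.commute)
    next
      case 3
      show ?thesis
      proof (cases "u \<le> z")
        case True
        then show ?thesis using 3 less.prems
          by (intro pA_submult_small[OF psubset.hyps(1) assms(2) psubset.prems(1)]) auto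
      next
        case False
        then have "pA ({1, d} \<union> T) n \<le> pA ({1, d} \<union> T) z * pA ({1, d} \<union> T) u"
          using 3 less.prems
          by (intro pA_submult_small[OF psubset.hyps(1) assms(2) psubset.prems(1)]) auto
        then show ?thesis by (simp add: mult.commute)
      qed
    qed
  qed
qed

text \<open>Parts above \<open>n + u + z\<close> occur in none of the three counts, so
  \<open>T\<close> may be truncated to a finite set.\<close>

lemma pA_submult:
  assumes "1 < d" "spaced d T" "n + d \<le> u + z"
  shows "pA ({1, d} \<union> T) n \<le> pA ({1, d} \<union> T) u * pA ({1, d} \<union> T) z"
proof -
  let ?T = "T \<inter> {..n + u + z}"
  have "pA ({1, d} \<union> T) m = pA ({1, d} \<union> ?T) m" if "m \<le> n + u + z" for m
    using that by (intro pA_cong_le) auto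
  moreover have "spaced d ?T" using assms(2) by (rule spaced_subset) simp
  ultimately show ?thesis using pA_submult_finite[of ?T d n u z] assms by simp
qed

section \<open>Paying for the shift by \<open>d\<close> with the part \<open>e\<close>\<close>

text \<open>A partition not consisting of ones has some part \<open>t\<close> in \<open>T\<close>,
  and deleting it leaves a partition of \<open>n - t\<close>. This is a union bound: a partition is
  counted once for each distinct \<open>t\<close> it contains.\<close>

lemma pA_le_sum_remove_part:
  assumes "finite T" "\<forall>t\<in>T. 1 < t"
  shows "pA ({1} \<union> T) n \<le> 1 + (\<Sum>t\<in>{t\<in>T. t \<le> n}. pA ({1} \<union> T) (n - t))"
  using assms
proof (induction T rule: finite_induct)
  case empty
  then show ?case by (simp add: pA_singleton_1 del: One_nat_def)
next
  case (insert b T)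
  let ?f = "pA ({1} \<union> T)" and ?g = "pA ({1} \<union> insert b T)"
  have "?f n \<le> 1 + (\<Sum>t\<in>{t\<in>T. t \<le> n}. ?f (n - t))"
    using insert.IH insert.prems by simp
  also have "\<dots> \<le> 1 + (\<Sum>t\<in>{t\<in>T. t \<le> n}. ?g (n - t))"
    by (intro add_left_mono sum_mono pA_mono_set) auto
  finally have IH: "?f n \<le> 1 + (\<Sum>t\<in>{t\<in>T. t \<le> n}. ?g (n - t))" .
  show ?case
  proof (cases "b \<le> n")
    case False
    have "?g n = ?f n"
    proof (rule pA_cong_le)
      show "({1} \<union> insert b T) \<inter> {..n} = ({1} \<union> T) \<inter> {..n}" using False by auto
    qed
    moreover have "{t\<in>insert b T. t \<le> n} = {t\<in>T. t \<le> n}" using False by auto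
    ultimately show ?thesis using IH by simp
  next
    case True
    have "({1} \<union> insert b T) - {b} = {1} \<union> T"
      using insert.hyps(2) insert.prems by auto
    then have "?g n = ?f n + ?g (n - b)"
      using pA_peel[of b "{1} \<union> insert b T" n] True insert.prems by simp
    moreover have "{t\<in>insert b T. t \<le> n} = insert b {t\<in>T. t \<le> n}" using True by auto
    ultimately show ?thesis using IH insert.hyps by simp
  qed
qed

text \<open>Peeling \<open>e\<close> repeatedly expands \<open>pA A (w - e)\<close> into terms
  \<open>pA (A - {e}) (w - i * e)\<close> with \<open>i \<ge> 1\<close>. As
  \<open>2 * e \<le> d\<close>, those for \<open>i = 2 * j - 1\<close> and \<open>i = 2 * j\<close>
  both dominate the term at \<open>w - j * d\<close>; the induction handles one such pair at a
  time.\<close>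

lemma twice_sum_le_pA:
  assumes "1 \<in> A" "e \<in> A" "1 < e" "2 * e \<le> d" "d \<le> w"
  shows "2 * (\<Sum>j=1..w div d. pA (A - {e}) (w - j * d)) \<le> pA A (w - e)"
  using assms(5)
proof (induction w rule: less_induct)
  case (less w)
  let ?f = "pA (A - {e})"
  have one: "1 \<in> A - {e}" using assms by simp
  have f: "?f (w - d) \<le> ?f (w - e)" "?f (w - d) \<le> ?f (w - e - e)"
    using assms(4) by (auto intro!: pA_mono[OF one])
  have peel: "pA A (w - e) = ?f (w - e) + pA A (w - e - e)"
    using assms less.prems by (intro pA_peel) auto
  have dpos: "0 < d" using assms by simp
  show ?case
  proof (cases "2 * d \<le> w")
    case False
    then have "w div d = 1" using less.prems by (simp add: div_nat_eqI)
    moreover have "?f (w - e - e) \<le> pA A (w - e - e)" by (rule pA_mono_set) auto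
    ultimately show ?thesis using f peel by simp
  next
    case True
    obtain q where q: "w div d = Suc q" "(w - d) div d = q"
      using less.prems dpos by (simp add: le_div_geq)
    \<comment> \<open>Shifting \<open>j\<close> by one turns the tail into the same sum for
      \<open>w - d\<close>.\<close>
    have "(\<Sum>j=1..w div d. ?f (w - j * d)) = ?f (w - d) + (\<Sum>j=2..Suc q. ?f (w - j * d))"
      unfolding q by (subst sum.atLeast_Suc_atMost) (auto simp: numeral_2_eq_2)
    also have "(\<Sum>j=2..Suc q. ?f (w - j * d)) = (\<Sum>j=1..q. ?f (w - d - j * d))"
      using sum.shift_bounds_cl_Suc_ivl[of "\<lambda>j. ?f (w - j * d)" 1 q]
      by (simp add: numeral_2_eq_2 diff_diff_add)
    finally have S: "(\<Sum>j=1..w div d. ?f (w - j * d))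
        = ?f (w - d) + (\<Sum>j=1..(w - d) div d. ?f (w - d - j * d))" using q by simp
    have "2 * (\<Sum>j=1..(w - d) div d. ?f (w - d - j * d)) \<le> pA A (w - d - e)"
      using True dpos by (intro less.IH) auto
    also have "\<dots> \<le> pA A (w - e - e - e)"
      using assms by (intro pA_mono) auto
    finally have "2 * (\<Sum>j=1..w div d. ?f (w - j * d)) \<le> 2 * ?f (w - d) + pA A (w - e - e - e)"
      using S by simp
    moreover have "pA A (w - e - e) = ?f (w - e - e) + pA A (w - e - e - e)"
      using assms True by (intro pA_peel) auto
    ultimately show ?thesis using f peel by simp
  qed
qed

text \<open>A partition of \<open>w + d\<close> with a part \<open>d\<close> loses that part; otherwise, unless all parts are 1, it
  loses a part \<open>t \<ge> 2 * d\<close> from \<open>T\<close>. The spacing makes the quotients \<open>t div d\<close> distinct, so the second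
  kind is bounded by a sum over multiples of \<open>d\<close>, each of which leaves room for two copies of \<open>e\<close>.\<close>

lemma pA_shift_le:
  assumes "1 < e" "2 * e \<le> d" "spaced d T" "d \<le> w"
  shows "pA ({1, d} \<union> T) (w + d) \<le> pA ({1, e, d} \<union> T) w"
proof -
  let ?B = "{1, d} \<union> T" and ?A = "{1, e, d} \<union> T" and ?T = "T \<inter> {..w + d}"
  let ?f = "pA ?B"
  \<comment> \<open>The 1 is subtracted because one multiple of \<open>d\<close> in \<open>t\<close>
    cancels the \<open>d\<close> of \<open>w + d\<close>; \<open>t \<ge> 2 * d\<close> keeps
    \<open>?g t\<close> positive.\<close>
  let ?S = "{t\<in>?T. t \<le> w + d}" and ?g = "\<lambda>t. t div d - 1"
  have T: "2 * d \<le> t" if "t \<in> T" for t using that assms(3) by (simp add: spaced_def)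
  have d: "1 < d" using assms by simp
  have AB: "?A - {e} = ?B" using T[of e] assms by auto
  have "?B - {d} = {1} \<union> T" using T[of d] d by auto
  then have "?f (w + d) = pA ({1} \<union> T) (w + d) + ?f w"
    using pA_peel[of d ?B "w + d"] d by simp
  also have "pA ({1} \<union> T) (w + d) = pA ({1} \<union> ?T) (w + d)"
    by (intro pA_cong_le) auto
  also have "\<dots> \<le> 1 + (\<Sum>t\<in>?S. pA ({1} \<union> ?T) (w + d - t))"
    using T d by (intro pA_le_sum_remove_part) fastforce+
  also have "\<dots> \<le> 1 + (\<Sum>t\<in>?S. ?f (w - ?g t * d))"
  proof (intro add_left_mono sum_mono)
    fix t assume "t \<in> ?S"
    then have "2 * d \<le> t" using T by simp
    moreover have "t div d * d \<le> t" by simp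
    moreover have "?g t * d = t div d * d - d" by (simp add: diff_mult_distrib)
    ultimately have "w + d - t \<le> w - ?g t * d" by linarith
    then have "?f (w + d - t) \<le> ?f (w - ?g t * d)" by (intro pA_mono) auto
    moreover have "pA ({1} \<union> ?T) (w + d - t) \<le> ?f (w + d - t)" by (intro pA_mono_set) auto
    ultimately show "pA ({1} \<union> ?T) (w + d - t) \<le> ?f (w - ?g t * d)" by simp
  qed
  also have "(\<Sum>t\<in>?S. ?f (w - ?g t * d)) \<le> (\<Sum>j=1..w div d. ?f (w - j * d))"
  proof -
    have ge2: "2 \<le> t div d" if "t \<in> ?S" for t
      using div_le_mono[of "2 * d" t d] T[of t] that d by simp
    have lt: "?g s \<noteq> ?g t" if "s \<in> ?S" "t \<in> ?S" "s < t" for s t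
    proof -
      have "s + d \<le> t" using assms(3) that by (simp add: spaced_def)
      then have "s div d < t div d" using d by (intro div_less_of_gap) auto
      then show ?thesis using ge2[OF that(1)] ge2[OF that(2)] by linarith
    qed
    have inj: "inj_on ?g ?S"
    proof (rule inj_onI)
      fix s t assume "s \<in> ?S" "t \<in> ?S" "?g s = ?g t"
      then show "s = t" using lt[of s t] lt[of t s] by (metis linorder_neqE_nat)
    qed
    have "?g ` ?S \<subseteq> {1..w div d}"
    proof
      fix j assume "j \<in> ?g ` ?S"
      then obtain t where t: "t \<in> ?S" "j = ?g t" by blast
      have "t div d \<le> (w + d) div d" using t(1) by (intro div_le_mono) simp
      also have "\<dots> = w div d + 1" using d by (intro div_add_self2) simp
      finally have "1 \<le> j" "j \<le> w div d" using ge2[OF t(1)] t(2) by linarith+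
      then show "j \<in> {1..w div d}" by simp
    qed
    then have "(\<Sum>j\<in>?g ` ?S. ?f (w - j * d)) \<le> (\<Sum>j=1..w div d. ?f (w - j * d))"
      by (intro sum_mono2) auto
    then show ?thesis unfolding sum.reindex[OF inj] o_def .
  qed
  \<comment> \<open>The partition into ones is absorbed by doubling the sum, whose term
    \<open>j = 1\<close> is present and positive because \<open>d \<le> w\<close>.\<close>
  also have "1 + (\<Sum>j=1..w div d. ?f (w - j * d)) \<le> 2 * (\<Sum>j=1..w div d. ?f (w - j * d))"
  proof -
    have "d div d \<le> w div d" using assms(4) by (rule div_le_mono)
    then have "1 \<in> {1..w div d}" using d by simp
    then have "?f (w - 1 * d) \<le> (\<Sum>j=1..w div d. ?f (w - j * d))"
      by (intro member_le_sum) auto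
    then show ?thesis using pA_pos[of ?B "w - 1 * d"] by simp
  qed
  also have "\<dots> \<le> pA ?A (w - e)"
    using twice_sum_le_pA[of ?A e d w] assms AB by simp
  finally have "?f (w + d) \<le> pA ?A (w - e) + ?f w" by simp
  moreover have "pA ?A w = ?f w + pA ?A (w - e)"
    using pA_peel[of e ?A w] AB assms by simp
  ultimately show ?thesis by simp
qed

section \<open>Induction for the full set, and the theorem\<close>

text \<open>Strictness originates in \<open>base\<close> alone: each induction step adds a weak
  inequality to the strict one for the pair with one argument lowered by \<open>e\<close>.\<close>

lemma pA_strict_submult:
  assumes "1 < e" "2 * e \<le> d" "spaced d T" and A: "A = {1, e, d} \<union> T"
    and base: "\<And>w z. d \<le> w \<Longrightarrow> d \<le> z \<Longrightarrow> w + z < 2 * (d + e) \<Longrightarrow> pA A (w + z) < pA A w * pA A z"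
    and "d \<le> w" "d \<le> z"
  shows "pA A (w + z) < pA A w * pA A z"
  using assms(6,7)
proof (induction "w + z" arbitrary: w z rule: less_induct)
  case less
  let ?B = "{1, d} \<union> T"
  have AB: "A - {e} = ?B" using assms(1-3) by (auto simp: A spaced_def)
  have peel: "pA A n = pA ?B n + pA A (n - e)" if "e \<le> n" for n
    using pA_peel[of e A n] AB that assms(1) by (simp add: A)
  have step: "pA A (w + z) < pA A w * pA A z"
    if "d \<le> w" "d + e \<le> z" "pA A (w + (z - e)) < pA A w * pA A (z - e)" for w z
  proof -
    \<comment> \<open>The shifted argument \<open>w + d\<close> supplies exactly the
      \<open>d\<close> that \<open>pA_submult\<close> loses.\<close>
    have "pA ?B (w + z) \<le> pA ?B (w + d) * pA ?B z"
      using assms(1-3) by (intro pA_submult) auto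
    also have "\<dots> \<le> pA A w * pA ?B z"
      using pA_shift_le[OF assms(1-3) that(1)] by (simp add: A)
    finally have "pA ?B (w + z) \<le> pA A w * pA ?B z" .
    moreover have "pA A (w + z) = pA ?B (w + z) + pA A (w + (z - e))"
      using peel[of "w + z"] that by simp
    moreover have "pA A z = pA ?B z + pA A (z - e)" using peel[of z] that by simp
    ultimately show ?thesis using that(3) by (simp add: distrib_left)
  qed
  \<comment> \<open>Outside the base range some argument can lose \<open>e\<close> and still be at
    least \<open>d\<close>.\<close>
  have "w + z < 2 * (d + e) \<or> d + e \<le> z \<or> d + e \<le> w" by arith
  then consider "w + z < 2 * (d + e)" | "d + e \<le> z" | "d + e \<le> w" by blast
  then show ?case
  proof cases
    case 1
    then show ?thesis using base less.prems by simp
  next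
    case 2
    have "pA A (w + (z - e)) < pA A w * pA A (z - e)"
      using 2 less.prems assms(1) by (intro less.hyps) linarith+
    then show ?thesis by (rule step[OF less.prems(1) 2])
  next
    case 3
    have "pA A (z + (w - e)) < pA A z * pA A (w - e)"
      using 3 less.prems assms(1) by (intro less.hyps) linarith+
    then have "pA A (z + w) < pA A z * pA A w" by (rule step[OF less.prems(2) 3])
    then show ?thesis by (simp add: ac_simps)
  qed
qed

theorem theorem1p4:
  fixes A I :: "nat set" and a :: "nat \<Rightarrow> nat"
  assumes "index_set I"
    and "A = a ` I"
    and "a 1 = 1"
    and "strict_mono_on I a"
    and "\<And>k l. k \<in> I \<Longrightarrow> l \<in> I \<Longrightarrow> k > l \<Longrightarrow> l \<ge> 3 \<Longrightarrow> a k - a l \<ge> a 3"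
    and "2 * a 2 \<le> a 3"
    and "\<And>w z. w \<ge> a 3 \<Longrightarrow> z \<ge> a 3 \<Longrightarrow> 2 * a 3 \<le> w + z \<Longrightarrow> w + z \<le> 2 * (a 3 + a 2) - 1
           \<Longrightarrow> pA A w * pA A z > pA A (w + z)"
  shows "\<forall>w z. w \<ge> a 3 \<longrightarrow> z \<ge> a 3 \<longrightarrow> pA A w * pA A z > pA A (w + z)"
proof (intro allI impI)
  fix w z assume wz: "a 3 \<le> w" "a 3 \<le> z"
  define T where "T = a ` {k \<in> I. 4 \<le> k}"
  have I: "1 \<in> I" "2 \<in> I" "3 \<in> I" "\<And>k. k \<in> I \<Longrightarrow> 1 \<le> k"
    using assms(1) by (auto simp: index_set_def)
  have less: "a k < a l" if "k \<in> I" "l \<in> I" "k < l" for k l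
    using assms(4) that by (auto simp: strict_mono_on_def)
  \<comment> \<open>The additive form avoids truncated subtraction; \<open>l = 3\<close> yields the
    lower bound \<open>2 * a 3\<close> in \<open>spaced\<close>.\<close>
  have gap: "a l + a 3 \<le> a k" if "k \<in> I" "l \<in> I" "l < k" "3 \<le> l" for k l
    using assms(5)[of k l] less[of l k] that by simp
  have I_eq: "I = {1, 2, 3} \<union> {k \<in> I. 4 \<le> k}"
    using I by fastforce
  have "A = a ` ({1, 2, 3} \<union> {k \<in> I. 4 \<le> k})"
    unfolding assms(2) using I_eq by (rule arg_cong)
  then have "A = {1, a 2, a 3} \<union> T"
    unfolding image_Un T_def using assms(3) by simp
  moreover have "spaced (a 3) T"
    unfolding spaced_def
  proof (intro ballI conjI impI)
    fix t assume "t \<in> T"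
    then obtain k where k: "k \<in> I" "4 \<le> k" "t = a k" by (auto simp: T_def)
    show "2 * a 3 \<le> t" using gap[of k 3] k I by simp
    fix s assume "s \<in> T" "s < t"
    then obtain l where l: "l \<in> I" "4 \<le> l" "s = a l" by (auto simp: T_def)
    have "l < k" using less[of k l] k l \<open>s < t\<close> by (metis linorder_neqE_nat less_asym')
    then show "s + a 3 \<le> t" using gap[of k l] k l by simp
  qed
  moreover have "1 < a 2" using less[of 1 2] I assms(3) by simp
  moreover have "pA A (w + z) < pA A w * pA A z"
    if "a 3 \<le> w" "a 3 \<le> z" "w + z < 2 * (a 3 + a 2)" for w z
    using that by (intro assms(7)) linarith+
  ultimately show "pA A w * pA A z > pA A (w + z)"
    using assms(6) wz pA_strict_submult[of "a 2" "a 3" T A w z] by blast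
qed

end
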